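(* Let $K_{n_1,n_2}$ be the complete bipartite graph on $n=n_1+n_2$ vertices with bipartition $(X,Y)$, $|X|=n_1$, $|Y|=n_2$, and $2\le n_1\le n_2$. Let $K^*_{n_1,n_2}$ be the graph obtained from $K_{n_1,n_2}$ by adding all edges among the vertices of $Y$. Then $\alpha(F_k(K^*_{n_1,n_2}))=\alpha(K^*_{n_1,n_2})=n_2$ for all such $n_1,n_2$ and all $k=1,\dots,n-1$.
   Context: $\alpha(G)$ denotes the algebraic connectivity of $G$, i.e. the second smallest eigenvalue of its Laplacian matrix. For a graph $G=(V,E)$ on $n$ vertices and $1\le k\le n-1$, the $k$-token graph $F_k(G)$ has as vertices the $k$-subsets of $V$, two $k$-subsets being adjacent iff their symmetric difference is $\{a,b\}$ with $ab\in E$. *)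

theory Defs
  imports
    "Graph_Theory.Graph_Theory"
    "Jordan_Normal_Form.Char_Poly"
    "HOL-Library.Multiset"
begin

text \<open>
  A finite simple graph is a \<^locale>\<open>pair_graph\<close>: every undirected edge \<open>ab\<close> is represented by
  both arcs \<open>(a, b)\<close> and \<open>(b, a)\<close>, so that \<^const>\<open>out_degree\<close> is the degree of a vertex.
\<close>

definition complete_bipartite :: "'a set \<Rightarrow> 'a set \<Rightarrow> 'a pair_pre_digraph" where
  "complete_bipartite X Y = \<lparr> pverts = X \<union> Y, parcs = X \<times> Y \<union> Y \<times> X \<rparr>"

definition complete_bipartite_star :: "'a set \<Rightarrow> 'a set \<Rightarrow> 'a pair_pre_digraph" where
  "complete_bipartite_star X Y =
     \<lparr> pverts = pverts (complete_bipartite X Y),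
       parcs = parcs (complete_bipartite X Y) \<union> {(u, v). u \<in> Y \<and> v \<in> Y \<and> u \<noteq> v} \<rparr>"

definition token_graph :: "nat \<Rightarrow> 'a pair_pre_digraph \<Rightarrow> 'a set pair_pre_digraph" where
  "token_graph k G =
     (let \<V> = {A. A \<subseteq> pverts G \<and> card A = k}
      in \<lparr> pverts = \<V>,
           parcs = {(A, B). A \<in> \<V> \<and> B \<in> \<V> \<and>
                            (\<exists>a b. sym_diff A B = {a, b} \<and> (a, b) \<in> parcs G)} \<rparr>)"

text \<open>The Laplacian matrix \<open>D - A\<close>, with rows and columns ordered by the vertex list \<open>vs\<close>.\<close>

definition laplacian_mat :: "'a pair_pre_digraph \<Rightarrow> 'a list \<Rightarrow> real mat" where
  "laplacian_mat G vs = mat (length vs) (length vs) (\<lambda>(i, j).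
     (if i = j then real (out_degree (with_proj G) (vs ! i)) else 0)
     - (if (vs ! i, vs ! j) \<in> parcs G then 1 else 0))"

definition eigenvalue_list :: "real mat \<Rightarrow> real list" where
  "eigenvalue_list A = sorted_list_of_multiset (proots (char_poly A))"

text \<open>
  Eigenvalues are counted with multiplicity, in increasing order starting at index 0. The value
  does not depend on the chosen enumeration of the vertices; see
  \<open>algebraic_connectivity_eq\<close> below. It is only meaningful for graphs with at least two vertices.
\<close>

definition algebraic_connectivity :: "'a pair_pre_digraph \<Rightarrow> real" where
  "algebraic_connectivity G =
     eigenvalue_list (laplacian_mat G (SOME vs. distinct vs \<and> set vs = pverts G)) ! 1"

lemma sum_nth_distinct:
  fixes g :: "'a \<Rightarrow> 'b :: comm_monoid_add"
  assumes "distinct vs"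
  shows "(\<Sum>j = 0..<length vs. g (vs ! j)) = sum g (set vs)"
  using sum.reindex_bij_betw[OF bij_betw_nth[OF assms refl refl], of g]
  by (simp add: atLeast0LessThan)

lemma char_poly_laplacian_enum:
  assumes vs: "distinct vs" and ws: "distinct ws" and eq: "set vs = set ws"
  shows "char_poly (laplacian_mat G vs) = char_poly (laplacian_mat G ws)"
proof -
  let ?n = "length vs"
  have len: "length ws = ?n" using assms distinct_card by metis
  define P where "P xs ys = mat ?n ?n (\<lambda>(i, j). if xs ! i = ys ! j then 1 else (0::real))"
    for xs ys :: "'a list"
  define f where "f u v = (if u = v then real (out_degree (with_proj G) u) else 0)
     - (if (u, v) \<in> parcs G then 1 else 0)" for u v
  have L: "laplacian_mat G xs = mat ?n ?n (\<lambda>(i, j). f (xs ! i) (xs ! j))"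
    if "distinct xs" "length xs = ?n" for xs
    using that by (auto simp: laplacian_mat_def f_def nth_eq_iff_index_eq intro!: eq_matI)
  have PP: "P xs ys * P ys xs = 1\<^sub>m ?n"
    if "distinct xs" "distinct ys" "length xs = ?n" "length ys = ?n" "set xs = set ys" for xs ys
  proof (rule eq_matI)
    fix i j assume "i < dim_row (1\<^sub>m ?n)" "j < dim_col (1\<^sub>m ?n)"
    then have ij: "i < ?n" "j < ?n" by auto
    have "(P xs ys * P ys xs) $$ (i, j)
        = (\<Sum>l = 0..<length ys. (\<lambda>y. (if xs ! i = y then 1 else 0) * (if y = xs ! j then 1 else 0)) (ys ! l))"
      using ij that by (auto simp: P_def scalar_prod_def intro!: sum.cong)
    also have "\<dots> = (\<Sum>y \<in> set ys. if xs ! i = y then (if y = xs ! j then 1 else 0) else 0)"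
      by (subst sum_nth_distinct[OF that(2), of "\<lambda>y. (if xs ! i = y then 1 else 0) * (if y = xs ! j then 1 else (0::real))"])
         (rule refl | rule sum.cong | simp)+
    also have "\<dots> = (if xs ! i = xs ! j then 1 else 0)"
      using that ij by (auto simp: sum.delta)
    finally show "(P xs ys * P ys xs) $$ (i, j) = 1\<^sub>m ?n $$ (i, j)"
      using ij that by (simp add: nth_eq_iff_index_eq)
  qed (auto simp: P_def)
  have LP: "laplacian_mat G vs * P vs ws = P vs ws * laplacian_mat G ws"
  proof (rule eq_matI)
    fix i j assume "i < dim_row (P vs ws * laplacian_mat G ws)"
      "j < dim_col (P vs ws * laplacian_mat G ws)"
    then have ij: "i < ?n" "j < ?n" using len by (auto simp: P_def laplacian_mat_def)
    have mem: "vs ! i \<in> set ws" "ws ! j \<in> set vs" using ij eq len by (metis nth_mem)+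
    have "(laplacian_mat G vs * P vs ws) $$ (i, j)
        = (\<Sum>l = 0..<length vs. (\<lambda>y. f (vs ! i) y * (if y = ws ! j then 1 else 0)) (vs ! l))"
      using ij len by (auto simp: L[OF vs refl] P_def scalar_prod_def intro!: sum.cong)
    also have "\<dots> = (\<Sum>y \<in> set vs. if y = ws ! j then f (vs ! i) y else 0)"
      by (subst sum_nth_distinct[OF vs, of "\<lambda>y. f (vs ! i) y * (if y = ws ! j then 1 else 0)"])
         (rule refl | rule sum.cong | simp)+
    also have "\<dots> = f (vs ! i) (ws ! j)" using mem by (auto simp: sum.delta')
    also have "\<dots> = (\<Sum>y \<in> set ws. if vs ! i = y then f y (ws ! j) else 0)"
      using mem by (auto simp: sum.delta)
    also have "\<dots> = (\<Sum>l = 0..<length ws. (\<lambda>y. (if vs ! i = y then 1 else 0) * f y (ws ! j)) (ws ! l))"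
      by (subst sum_nth_distinct[OF ws, of "\<lambda>y. (if vs ! i = y then 1 else 0) * f y (ws ! j)"])
         (rule refl | rule sum.cong | simp)+
    also have "\<dots> = (P vs ws * laplacian_mat G ws) $$ (i, j)"
      using ij len by (auto simp: L[OF ws len] P_def scalar_prod_def intro!: sum.cong)
    finally show "(laplacian_mat G vs * P vs ws) $$ (i, j) = (P vs ws * laplacian_mat G ws) $$ (i, j)" .
  qed (auto simp: P_def laplacian_mat_def len)
  have carr: "laplacian_mat G vs \<in> carrier_mat ?n ?n" "laplacian_mat G ws \<in> carrier_mat ?n ?n"
    "P vs ws \<in> carrier_mat ?n ?n" "P ws vs \<in> carrier_mat ?n ?n"
    by (auto simp: laplacian_mat_def P_def len)
  have "laplacian_mat G vs = laplacian_mat G vs * (P vs ws * P ws vs)"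
    using PP[OF vs ws refl len eq] carr by simp
  also have "\<dots> = P vs ws * laplacian_mat G ws * P ws vs"
    using carr LP by (simp flip: assoc_mult_mat)
  finally have "similar_mat_wit (laplacian_mat G vs) (laplacian_mat G ws) (P vs ws) (P ws vs)"
    using carr PP[OF vs ws refl len eq] PP[OF ws vs len refl eq[symmetric]]
    by (auto simp: similar_mat_wit_def Let_def)
  then show ?thesis by (intro char_poly_similar) (auto simp: similar_mat_def)
qed

lemma algebraic_connectivity_eq:
  assumes "distinct vs" "set vs = pverts G"
  shows "algebraic_connectivity G = eigenvalue_list (laplacian_mat G vs) ! 1"
proof -
  let ?ws = "SOME vs. distinct vs \<and> set vs = pverts G"
  have "distinct ?ws \<and> set ?ws = pverts G"
    by (rule someI[of _ vs]) (use assms in auto)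
  then show ?thesis
    using char_poly_laplacian_enum[of ?ws vs G] assms
    by (simp add: algebraic_connectivity_def eigenvalue_list_def)
qed

lemma complete_bipartite_digraph_complete_bipartite:
  assumes "finite X" "finite Y" "X \<inter> Y = {}"
  shows "complete_bipartite_digraph (card X) (card Y) (with_proj (complete_bipartite X Y))"
  unfolding complete_bipartite_digraph_pair_def
  using assms by (auto simp: complete_bipartite_def)

lemma pair_graph_complete_bipartite_star:
  assumes "finite X" "finite Y" "X \<inter> Y = {}"
  shows "pair_graph (complete_bipartite_star X Y)"
proof
  let ?G = "complete_bipartite_star X Y"
  have "parcs ?G \<subseteq> (X \<union> Y) \<times> (X \<union> Y)"
    by (auto simp: complete_bipartite_star_def complete_bipartite_def)
  then show "finite (parcs ?G)" by (rule finite_subset) (use assms in auto)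
qed (use assms in \<open>auto simp: complete_bipartite_star_def complete_bipartite_def
      symmetric_def sym_def\<close>)

lemma pair_graph_token_graph:
  assumes "pair_graph G"
  shows "pair_graph (token_graph k G)"
proof -
  interpret pair_graph G by fact
  show ?thesis
  proof
    have V: "finite {A. A \<subseteq> pverts G \<and> card A = k}" using pair_finite_verts by simp
    then show "finite (pverts (token_graph k G))" by (simp add: token_graph_def)
    have "parcs (token_graph k G)
        \<subseteq> {A. A \<subseteq> pverts G \<and> card A = k} \<times> {A. A \<subseteq> pverts G \<and> card A = k}"
      by (auto simp: token_graph_def Let_def)
    then show "finite (parcs (token_graph k G))"
      by (rule finite_subset) (use V in auto)
    show "symmetric (with_proj (token_graph k G))"
      unfolding symmetric_def with_proj_simps
    proof (rule symI)
      fix A B assume "(A, B) \<in> parcs (token_graph k G)"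
      moreover have "sym_diff B A = sym_diff A B" by (rule Un_commute)
      ultimately show "(B, A) \<in> parcs (token_graph k G)"
        unfolding token_graph_def Let_def by simp
    qed
    fix e assume "e \<in> parcs (token_graph k G)"
    then obtain A B a b where e: "e = (A, B)"
      and AB: "A \<in> pverts (token_graph k G)" "B \<in> pverts (token_graph k G)"
      and ab: "sym_diff A B = {a, b}"
      unfolding token_graph_def Let_def by auto
    show "fst e \<in> pverts (token_graph k G)" "snd e \<in> pverts (token_graph k G)"
      using e AB by simp_all
    show "fst e \<noteq> snd e"
    proof
      assume "fst e = snd e"
      then have "sym_diff A B = {}" using e by simp
      then show False using ab by (simp only: insert_not_empty)
    qed
  qed
qed

end

theory Submission
  imports Defs
begin

text \<open>
  Every vertex of \<open>Y\<close> is adjacent to all other vertices, so the graph arises from the empty graph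
  on \<open>X\<close> by adding \<open>n\<^sub>2\<close> dominating vertices one at a time. If all token graphs of a graph on
  \<open>n\<close> vertices have spectral gap at least \<open>a \<le> n\<close>, then adding a dominating vertex \<open>v\<close> raises
  the bound to \<open>a + 1\<close>: a function on the \<open>k\<close>-sets is split into the parts living on sets
  avoiding and containing \<open>v\<close>, the means of both parts are subtracted, and the energy between the
  two mean-free parts is at least their squared norm. The last estimate rests on the spectral gap
  \<open>n\<close> of the Johnson graphs, which is obtained by the same induction for complete graphs.
  Equality holds because \<open>A \<mapsto> [p \<in> A] - [q \<in> A]\<close> with distinct \<open>p, q \<in> X\<close> is an eigenfunction for
  \<open>n\<^sub>2\<close>.
\<close>

section \<open>Sums over sets of fixed size\<close>

definition ksets :: "'a set \<Rightarrow> nat \<Rightarrow> 'a set set" where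
  "ksets V k = {A. A \<subseteq> V \<and> card A = k}"

lemma finite_ksets [simp]: "finite V \<Longrightarrow> finite (ksets V k)"
  by (simp add: ksets_def)

lemma ksetsD:
  assumes "A \<in> ksets V k"
  shows "A \<subseteq> V" "card A = k"
  using assms by (auto simp: ksets_def)

lemma finite_ksets_member: "finite V \<Longrightarrow> A \<in> ksets V k \<Longrightarrow> finite A"
  using finite_subset by (auto simp: ksets_def)

lemma ksets_0: "finite V \<Longrightarrow> ksets V 0 = {{}}"
  by (auto simp: ksets_def dest: finite_subset)

lemma ksets_insert_member:
  assumes "finite V" "B \<in> ksets V m" "y \<in> V - B"
  shows "insert y B \<in> ksets V (Suc m)"
  using assms finite_ksets_member[OF assms(1,2)] by (simp add: ksets_def)

lemma ksets_remove_member: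
  assumes "A \<in> ksets V (Suc m)" "x \<in> A"
  shows "A - {x} \<in> ksets V m"
  using assms by (auto simp: ksets_def)

text \<open>Double counting of the pairs \<open>B\<close> below \<open>A\<close> in consecutive
  layers: deleting \<open>x\<close> from \<open>A\<close> and adding \<open>y\<close> to
  \<open>B\<close> are mutually inverse on such pairs. Every passage between layers \<open>m\<close>
  and \<open>Suc m\<close> goes through this identity.\<close>

lemma sum_ksets_Suc:
  assumes "finite V"
  shows "(\<Sum>A\<in>ksets V (Suc m). \<Sum>x\<in>A. h A x)
       = (\<Sum>B\<in>ksets V m. \<Sum>y\<in>V - B. h (insert y B) y)"
proof -
  have fin: "finite A" if "A \<in> ksets V k" for A k
    using that assms by (rule finite_ksets_member[rotated])
  have "(\<Sum>A\<in>ksets V (Suc m). \<Sum>x\<in>A. h A x)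
      = (\<Sum>(A, x)\<in>Sigma (ksets V (Suc m)) (\<lambda>A. A). h A x)"
    using assms fin by (intro sum.Sigma) auto
  also have "\<dots> = (\<Sum>(B, y)\<in>Sigma (ksets V m) (\<lambda>B. V - B). h (insert y B) y)"
    by (rule sum.reindex_bij_witness[of _ "\<lambda>(B, y). (insert y B, y)" "\<lambda>(A, x). (A - {x}, x)"])
      (auto simp: insert_absorb ksets_remove_member ksets_insert_member[OF assms]
        dest: ksetsD(1))
  also have "\<dots> = (\<Sum>B\<in>ksets V m. \<Sum>y\<in>V - B. h (insert y B) y)"
    using assms by (intro sum.Sigma[symmetric]) auto
  finally show ?thesis .
qed

lemma sum_ksets_insert:
  assumes "finite V" "v \<notin> V"
  shows "sum h (ksets (insert v V) (Suc m))
       = sum h (ksets V (Suc m)) + (\<Sum>B\<in>ksets V m. h (insert v B))"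
proof -
  have split: "ksets (insert v V) (Suc m) = ksets V (Suc m) \<union> insert v ` ksets V m"
  proof (intro equalityI subsetI)
    fix A assume A: "A \<in> ksets (insert v V) (Suc m)"
    show "A \<in> ksets V (Suc m) \<union> insert v ` ksets V m"
    proof (cases "v \<in> A")
      case True
      then have "A = insert v (A - {v})" "A - {v} \<in> ksets V m"
        using A assms by (auto simp: ksets_def)
      then show ?thesis by blast
    qed (use A in \<open>auto simp: ksets_def\<close>)
  next
    fix A assume "A \<in> ksets V (Suc m) \<union> insert v ` ksets V m"
    then show "A \<in> ksets (insert v V) (Suc m)"
      using assms ksets_insert_member[of "insert v V" _ m v]
      by (auto simp: ksets_def)
  qed
  have inj: "inj_on (insert v) (ksets V m)"
    using assms by (intro inj_onI) (metis insert_ident ksetsD(1) subsetD)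
  have "ksets V (Suc m) \<inter> insert v ` ksets V m = {}"
    using assms by (auto simp: ksets_def)
  then show ?thesis
    using assms inj by (simp add: split sum.union_disjoint sum.reindex)
qed

lemma card_Diff_ksets:
  assumes "finite V" "B \<in> ksets V m"
  shows "real (card (V - B)) = real (card V) - real m"
  using assms by (metis card_Diff_subset card_mono finite_ksets_member ksetsD of_nat_diff)

text \<open>The case \<open>h = 1\<close> of the double count. Subtraction is taken in the reals;
  for \<open>m > card V\<close> both layers are empty and both sides vanish.\<close>

lemma card_ksets_Suc:
  assumes "finite V"
  shows "real (Suc m) * real (card (ksets V (Suc m)))
       = (real (card V) - real m) * real (card (ksets V m))"
proof -
  have "(\<Sum>A\<in>ksets V (Suc m). \<Sum>x\<in>A. 1) = (\<Sum>B\<in>ksets V m. \<Sum>y\<in>V - B. 1::real)"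
    by (rule sum_ksets_Suc) fact
  moreover have "(\<Sum>A\<in>ksets V (Suc m). \<Sum>x\<in>A. 1) = (\<Sum>A\<in>ksets V (Suc m). real (Suc m))"
    by (intro sum.cong) (auto dest: ksetsD)
  moreover have "(\<Sum>B\<in>ksets V m. \<Sum>y\<in>V - B. 1) = (\<Sum>B\<in>ksets V m. real (card V) - real m)"
    by (intro sum.cong) (auto simp: card_Diff_ksets[OF assms])
  ultimately show ?thesis by (simp add: mult.commute)
qed

section \<open>Spectral gaps of token graphs\<close>

text \<open>The sum counts every edge of the token graph twice, hence the division by 2.\<close>

definition token_energy ::
    "('a \<Rightarrow> 'a \<Rightarrow> real) \<Rightarrow> 'a set \<Rightarrow> nat \<Rightarrow> ('a set \<Rightarrow> real) \<Rightarrow> real" where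
  "token_energy w V k f =
     (\<Sum>A\<in>ksets V k. \<Sum>x\<in>A. \<Sum>y\<in>V - A. w x y * (f A - f (insert y (A - {x})))\<^sup>2) / 2"

text \<open>A lower bound for the Rayleigh quotient on mean-free functions. Over a finite
  \<open>V\<close> it holds trivially when the layer is empty or a singleton, so inductions can
  quantify over all \<open>k\<close> without side conditions.\<close>

definition token_gap :: "('a \<Rightarrow> 'a \<Rightarrow> real) \<Rightarrow> 'a set \<Rightarrow> nat \<Rightarrow> real \<Rightarrow> bool" where
  "token_gap w V k a \<longleftrightarrow>
     (\<forall>f. sum f (ksets V k) = 0 \<longrightarrow> a * (\<Sum>A\<in>ksets V k. (f A)\<^sup>2) \<le> token_energy w V k f)"

lemma token_energy_nonneg:
  assumes "\<And>x y. 0 \<le> w x y"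
  shows "0 \<le> token_energy w V k f"
  unfolding token_energy_def using assms by (intro divide_nonneg_pos sum_nonneg) auto

lemma token_gap_0: "(\<And>x y. 0 \<le> w x y) \<Longrightarrow> token_gap w V k 0"
  by (simp add: token_gap_def token_energy_nonneg)

text \<open>Edges are sorted by how many of their two ends contain \<open>v\<close>: none, both, or
  exactly one. In the last case a token moves between \<open>v\<close> and some \<open>y\<close>
  along an edge of weight 1 while the other tokens form \<open>B\<close>. Each such edge is met once
  from either end, which cancels the division by 2.\<close>

lemma token_energy_insert:
  assumes V: "finite V" "v \<notin> V" and w: "\<And>x. x \<in> V \<Longrightarrow> w x v = 1" "\<And>x. x \<in> V \<Longrightarrow> w v x = 1"
  shows "token_energy w (insert v V) (Suc m) f
       = token_energy w V (Suc m) f + token_energy w V m (\<lambda>B. f (insert v B))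
         + (\<Sum>B\<in>ksets V m. \<Sum>y\<in>V - B. (f (insert v B) - f (insert y B))\<^sup>2)"
proof -
  let ?t = "\<lambda>A x y. w x y * (f A - f (insert y (A - {x})))\<^sup>2"
  let ?g = "\<lambda>B. f (insert v B)"
  let ?C = "\<Sum>B\<in>ksets V m. \<Sum>y\<in>V - B. (f (insert v B) - f (insert y B))\<^sup>2"
  have "(\<Sum>A\<in>ksets V (Suc m). \<Sum>x\<in>A. \<Sum>y\<in>insert v V - A. ?t A x y)
      = (\<Sum>A\<in>ksets V (Suc m). \<Sum>x\<in>A. (f A - f (insert v (A - {x})))\<^sup>2 + (\<Sum>y\<in>V - A. ?t A x y))"
  proof (intro sum.cong refl)
    fix A x assume A: "A \<in> ksets V (Suc m)" "x \<in> A"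
    then have "insert v V - A = insert v (V - A)" "w x v = 1"
      using V w ksetsD(1)[OF A(1)] by auto
    then show "(\<Sum>y\<in>insert v V - A. ?t A x y)
        = (f A - f (insert v (A - {x})))\<^sup>2 + (\<Sum>y\<in>V - A. ?t A x y)"
      using V by simp
  qed
  also have "\<dots> = (\<Sum>A\<in>ksets V (Suc m). \<Sum>x\<in>A. (f A - f (insert v (A - {x})))\<^sup>2)
      + 2 * token_energy w V (Suc m) f"
    by (simp add: sum.distrib token_energy_def)
  also have "(\<Sum>A\<in>ksets V (Suc m). \<Sum>x\<in>A. (f A - f (insert v (A - {x})))\<^sup>2) = ?C"
    by (subst sum_ksets_Suc[OF V(1)]) (auto intro!: sum.cong simp: power2_commute)
  finally have 1: "(\<Sum>A\<in>ksets V (Suc m). \<Sum>x\<in>A. \<Sum>y\<in>insert v V - A. ?t A x y)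
      = ?C + 2 * token_energy w V (Suc m) f" .
  have "(\<Sum>B\<in>ksets V m. \<Sum>x\<in>insert v B. \<Sum>y\<in>insert v V - insert v B. ?t (insert v B) x y)
      = (\<Sum>B\<in>ksets V m. (\<Sum>y\<in>V - B. (f (insert v B) - f (insert y B))\<^sup>2)
         + (\<Sum>x\<in>B. \<Sum>y\<in>V - B. w x y * (?g B - ?g (insert y (B - {x})))\<^sup>2))"
  proof (intro sum.cong refl)
    fix B assume B: "B \<in> ksets V m"
    then have *: "insert v V - insert v B = V - B" "v \<notin> B" "finite B"
      using V ksetsD(1)[OF B] finite_ksets_member by auto
    have "(\<Sum>y\<in>V - B. ?t (insert v B) v y) = (\<Sum>y\<in>V - B. (f (insert v B) - f (insert y B))\<^sup>2)"
      using * w by (intro sum.cong) auto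
    moreover have "(\<Sum>x\<in>B. \<Sum>y\<in>V - B. ?t (insert v B) x y)
        = (\<Sum>x\<in>B. \<Sum>y\<in>V - B. w x y * (?g B - ?g (insert y (B - {x})))\<^sup>2)"
    proof (intro sum.cong refl)
      fix x y assume "x \<in> B"
      then have "insert y (insert v B - {x}) = insert v (insert y (B - {x}))"
        using * by auto
      then show "?t (insert v B) x y = w x y * (?g B - ?g (insert y (B - {x})))\<^sup>2" by simp
    qed
    ultimately show "(\<Sum>x\<in>insert v B. \<Sum>y\<in>insert v V - insert v B. ?t (insert v B) x y)
      = (\<Sum>y\<in>V - B. (f (insert v B) - f (insert y B))\<^sup>2)
         + (\<Sum>x\<in>B. \<Sum>y\<in>V - B. w x y * (?g B - ?g (insert y (B - {x})))\<^sup>2)"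
      unfolding *(1) using *(2,3) by simp
  qed
  also have "\<dots> = ?C + 2 * token_energy w V m ?g"
    by (simp add: sum.distrib token_energy_def)
  finally show ?thesis
    using 1 sum_ksets_insert[OF V, of "\<lambda>A. \<Sum>x\<in>A. \<Sum>y\<in>insert v V - A. ?t A x y" m]
    by (simp add: token_energy_def[of w "insert v V"])
qed

text \<open>Lagrange's identity: the Cauchy-Schwarz inequality against the all-ones vector, with its
  exact defect.\<close>

lemma power2_sum_eq_pairwise:
  fixes u :: "'a \<Rightarrow> real"
  shows "(\<Sum>x\<in>A. u x)\<^sup>2
       = real (card A) * (\<Sum>x\<in>A. (u x)\<^sup>2) - (\<Sum>x\<in>A. \<Sum>y\<in>A. (u x - u y)\<^sup>2) / 2"
proof -
  have "(\<Sum>x\<in>A. \<Sum>y\<in>A. (u x - u y)\<^sup>2)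
      = (\<Sum>x\<in>A. \<Sum>y\<in>A. (u x)\<^sup>2) + (\<Sum>x\<in>A. \<Sum>y\<in>A. (u y)\<^sup>2) - 2 * (\<Sum>x\<in>A. \<Sum>y\<in>A. u x * u y)"
    by (simp add: power2_diff sum.distrib sum_subtractf sum_distrib_left mult.assoc)
  also have "(\<Sum>x\<in>A. \<Sum>y\<in>A. u x * u y) = (\<Sum>x\<in>A. u x)\<^sup>2"
    by (simp add: power2_eq_square sum_product)
  finally show ?thesis by (simp add: diff_divide_distrib flip: sum_distrib_left)
qed

text \<open>Write F and G for the squared norms of \<open>f\<close> and \<open>g\<close>, and n for
  \<open>card V\<close>. Expanding the square gives (n - m) G + (m + 1) F minus twice the inner
  product of \<open>f\<close> with the lift of \<open>g\<close> to layer \<open>Suc m\<close>. The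
  Johnson gap bounds the squared norm of that lift by m (n - m - 1) G, and AM-GM then bounds the
  mixed term by m F + (n - m - 1) G, which leaves F + G.\<close>

lemma cross_energy_ge:
  fixes f g :: "'a set \<Rightarrow> real"
  assumes V: "finite V" and gap: "token_gap (\<lambda>_ _. 1) V m (real (card V))"
    and g0: "sum g (ksets V m) = 0"
  shows "(\<Sum>A\<in>ksets V (Suc m). (f A)\<^sup>2) + (\<Sum>B\<in>ksets V m. (g B)\<^sup>2)
       \<le> (\<Sum>B\<in>ksets V m. \<Sum>y\<in>V - B. (g B - f (insert y B))\<^sup>2)"
proof -
  let ?n = "real (card V)"
  let ?K = "ksets V (Suc m)"
  define F where "F = (\<Sum>A\<in>?K. (f A)\<^sup>2)"
  define G where "G = (\<Sum>B\<in>ksets V m. (g B)\<^sup>2)"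
  \<comment> \<open>The up operator applied to \<open>g\<close>: it sums \<open>g\<close> over the
    sets one layer below \<open>A\<close>, so the mixed term of the cross energy is the inner
    product of \<open>f\<close> and \<open>U\<close>.\<close>
  define U where "U A = (\<Sum>x\<in>A. g (A - {x}))" for A
  define C where "C = (\<Sum>B\<in>ksets V m. \<Sum>y\<in>V - B. (g B - f (insert y B))\<^sup>2)"
  have gg: "(\<Sum>A\<in>?K. \<Sum>x\<in>A. (g (A - {x}))\<^sup>2) = (?n - real m) * G"
  proof -
    have "(\<Sum>A\<in>?K. \<Sum>x\<in>A. (g (A - {x}))\<^sup>2) = (\<Sum>B\<in>ksets V m. \<Sum>y\<in>V - B. (g B)\<^sup>2)"
      by (subst sum_ksets_Suc[OF V]) (auto intro!: sum.cong)
    also have "\<dots> = (\<Sum>B\<in>ksets V m. (?n - real m) * (g B)\<^sup>2)"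
      by (intro sum.cong) (auto simp: card_Diff_ksets[OF V])
    finally show ?thesis by (simp add: G_def sum_distrib_left)
  qed
  have C: "C = (?n - real m) * G + real (Suc m) * F - 2 * (\<Sum>A\<in>?K. f A * U A)"
  proof -
    have "C = (\<Sum>A\<in>?K. \<Sum>x\<in>A. (g (A - {x}) - f A)\<^sup>2)"
      unfolding C_def by (subst sum_ksets_Suc[OF V]) (auto intro!: sum.cong)
    also have "\<dots> = (\<Sum>A\<in>?K. (\<Sum>x\<in>A. (g (A - {x}))\<^sup>2) + real (Suc m) * (f A)\<^sup>2 - 2 * (f A * U A))"
      by (intro sum.cong refl)
        (simp add: power2_diff sum.distrib sum_subtractf sum_distrib_left U_def ksetsD mult_ac)
    also have "\<dots> = (?n - real m) * G + real (Suc m) * F - 2 * (\<Sum>A\<in>?K. f A * U A)"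
      by (simp only: sum.distrib sum_subtractf gg sum_distrib_left F_def)
    finally show ?thesis .
  qed
  have UU: "(\<Sum>A\<in>?K. (U A)\<^sup>2) \<le> real m * (?n - real m - 1) * G"
  proof -
    \<comment> \<open>Two distinct subsets of size \<open>m\<close> of one \<open>A\<close> are
      neighbours in the Johnson graph: with \<open>A = insert y B\<close>, deleting \<open>x\<close>
      instead of \<open>y\<close> trades \<open>x\<close> for \<open>y\<close> in \<open>B\<close>.
      Thus the defect in Lagrange's identity, summed over all \<open>A\<close>, is the Johnson
      energy of \<open>g\<close>.\<close>
    have "(\<Sum>A\<in>?K. \<Sum>x\<in>A. \<Sum>y\<in>A. (g (A - {x}) - g (A - {y}))\<^sup>2)
        = (\<Sum>B\<in>ksets V m. \<Sum>y\<in>V - B. \<Sum>x\<in>B. (g B - g (insert y (B - {x})))\<^sup>2)"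
    proof (subst sum_ksets_Suc[OF V], rule sum.cong[OF refl], rule sum.cong[OF refl])
      fix B y assume B: "B \<in> ksets V m" "y \<in> V - B"
      then have "(\<Sum>x\<in>insert y B. (g (insert y B - {y}) - g (insert y B - {x}))\<^sup>2)
          = (\<Sum>x\<in>B. (g B - g (insert y B - {x}))\<^sup>2)"
        using finite_ksets_member[OF V B(1)] by simp
      also have "\<dots> = (\<Sum>x\<in>B. (g B - g (insert y (B - {x})))\<^sup>2)"
      proof (intro sum.cong refl)
        fix x assume "x \<in> B"
        then have "insert y B - {x} = insert y (B - {x})" using B by auto
        then show "(g B - g (insert y B - {x}))\<^sup>2 = (g B - g (insert y (B - {x})))\<^sup>2" by simp
      qed
      finally show "(\<Sum>x\<in>insert y B. (g (insert y B - {y}) - g (insert y B - {x}))\<^sup>2)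
          = (\<Sum>x\<in>B. (g B - g (insert y (B - {x})))\<^sup>2)" .
    qed
    also have "\<dots> = 2 * token_energy (\<lambda>_ _. 1) V m g"
      unfolding token_energy_def by (simp, intro sum.cong refl sum.swap)
    finally have E: "(\<Sum>A\<in>?K. \<Sum>x\<in>A. \<Sum>y\<in>A. (g (A - {x}) - g (A - {y}))\<^sup>2)
        = 2 * token_energy (\<lambda>_ _. 1) V m g" .
    have "(\<Sum>A\<in>?K. (U A)\<^sup>2) = (\<Sum>A\<in>?K. real (Suc m) * (\<Sum>x\<in>A. (g (A - {x}))\<^sup>2)
        - (\<Sum>x\<in>A. \<Sum>y\<in>A. (g (A - {x}) - g (A - {y}))\<^sup>2) / 2)"
      unfolding U_def by (intro sum.cong refl) (subst power2_sum_eq_pairwise, simp add: ksetsD)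
    also have "\<dots> = real (Suc m) * ((?n - real m) * G) - token_energy (\<lambda>_ _. 1) V m g"
      by (simp only: sum_subtractf gg[symmetric] sum_distrib_left[symmetric]
          sum_divide_distrib[symmetric] E)
    also have "\<dots> \<le> real (Suc m) * ((?n - real m) * G) - ?n * G"
      using gap g0 by (simp add: token_gap_def G_def)
    finally show ?thesis by (simp add: algebra_simps)
  qed
  have "F + G \<le> C"
  \<comment> \<open>The AM-GM weight requires division by \<open>m\<close>. For \<open>m = 0\<close>
    the layer of \<open>g\<close> is the single set \<open>{}\<close>, so mean-free means zero and
    the mixed term disappears.\<close>
  proof (cases "m = 0")
    case True
    then have "g {} = 0" using g0 V by (simp add: ksets_0)
    then have "G = 0" "\<And>A. A \<in> ?K \<Longrightarrow> U A = 0"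
      using True V by (auto simp: G_def U_def ksets_0 dest!: ksetsD card_eq_SucD)
    then show ?thesis using C True by simp
  next
    case False
    \<comment> \<open>AM-GM in the form \<open>2 m f U \<le> m\<^sup>2 f\<^sup>2 + U\<^sup>2\<close>\<close>
    have "real m * (2 * (\<Sum>A\<in>?K. f A * U A)) \<le> (\<Sum>A\<in>?K. (real m)\<^sup>2 * (f A)\<^sup>2 + (U A)\<^sup>2)"
      unfolding sum_distrib_left
    proof (intro sum_mono)
      fix A
      show "real m * (2 * (f A * U A)) \<le> (real m)\<^sup>2 * (f A)\<^sup>2 + (U A)\<^sup>2"
        using zero_le_power2[of "real m * f A - U A"]
        by (simp add: power2_diff power_mult_distrib mult_ac)
    qed
    also have "\<dots> = (real m)\<^sup>2 * F + (\<Sum>A\<in>?K. (U A)\<^sup>2)"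
      by (simp add: sum.distrib F_def sum_distrib_left)
    finally have "real m * (F + G) \<le> real m * C"
      using UU unfolding C by (simp add: algebra_simps power2_eq_square)
    then show ?thesis using False by simp
  qed
  then show ?thesis by (simp add: F_def G_def C_def)
qed

section \<open>Adding a dominating vertex\<close>

lemma token_energy_diff_const: "token_energy w V k (\<lambda>A. f A - c) = token_energy w V k f"
  by (simp add: token_energy_def)

text \<open>Pythagoras for the splitting into mean and mean-free part. The mean is specified by a
  product instead of a quotient, which covers an empty \<open>S\<close>.\<close>

lemma sum_power2_diff_mean:
  fixes f :: "'a \<Rightarrow> real"
  assumes "finite S" and c: "c * real (card S) = sum f S"
  shows "(\<Sum>x\<in>S. f x - c) = 0" and "(\<Sum>x\<in>S. (f x)\<^sup>2) = (\<Sum>x\<in>S. (f x - c)\<^sup>2) + c\<^sup>2 * real (card S)"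
proof -
  show "(\<Sum>x\<in>S. f x - c) = 0" using c by (simp add: sum_subtractf mult.commute)
  have "(\<Sum>x\<in>S. (f x - c)\<^sup>2) = (\<Sum>x\<in>S. (f x)\<^sup>2 + c\<^sup>2 - 2 * c * f x)"
    by (simp add: power2_diff mult_ac)
  also have "\<dots> = (\<Sum>x\<in>S. (f x)\<^sup>2) + c\<^sup>2 * real (card S) - 2 * c * sum f S"
    by (simp only: sum.distrib sum_subtractf sum_distrib_left[symmetric]) simp
  finally show "(\<Sum>x\<in>S. (f x)\<^sup>2) = (\<Sum>x\<in>S. (f x - c)\<^sup>2) + c\<^sup>2 * real (card S)"
    unfolding c[symmetric] by (simp add: power2_eq_square algebra_simps)
qed

text \<open>The mean-free parts on the two layers gain \<open>a\<close> times their squared norm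
  from \<open>gap\<close> and once more their squared norm from the cross energy. The two means
  contribute exactly \<open>card V + 1\<close> times their squared norm, and this is where
  \<open>a \<le> card V\<close> enters. The bound is assumed for all \<open>k\<close> because layers
  \<open>k\<close> and \<open>k - 1\<close> both occur.\<close>

lemma token_gap_insert:
  fixes V :: "'a set"
  assumes V: "finite V" "v \<notin> V" and w: "\<And>x. x \<in> V \<Longrightarrow> w x v = 1" "\<And>x. x \<in> V \<Longrightarrow> w v x = 1"
    and gap: "\<And>k. token_gap w V k a"
    and johnson: "\<And>k. token_gap (\<lambda>_ _. 1) V k (real (card V))"
    and a: "a \<le> real (card V)"
  shows "token_gap w (insert v V) k (a + 1)"
  unfolding token_gap_def
proof (intro allI impI)
  fix f :: "'a set \<Rightarrow> real" assume f0: "sum f (ksets (insert v V) k) = 0"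
  show "(a + 1) * (\<Sum>A\<in>ksets (insert v V) k. (f A)\<^sup>2) \<le> token_energy w (insert v V) k f"
  proof (cases k)
    case 0
    then show ?thesis using f0 V by (simp add: ksets_0 token_energy_def)
  next
    case (Suc m)
    let ?n = "real (card V)"
    define g where "g B = f (insert v B)" for B
    define N1 where "N1 = real (card (ksets V (Suc m)))"
    define N0 where "N0 = real (card (ksets V m))"
    define c where "c = sum f (ksets V (Suc m)) / N1"
    define d where "d = sum g (ksets V m) / N0"
    have c: "c * N1 = sum f (ksets V (Suc m))" and d: "d * N0 = sum g (ksets V m)"
      using V by (auto simp: c_def d_def N1_def N0_def)
    note f' = sum_power2_diff_mean[OF finite_ksets[OF V(1)] c[unfolded N1_def], folded N1_def]
    note g' = sum_power2_diff_mean[OF finite_ksets[OF V(1)] d[unfolded N0_def], folded N0_def]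
    define F where "F = (\<Sum>A\<in>ksets V (Suc m). (f A - c)\<^sup>2)"
    define G where "G = (\<Sum>B\<in>ksets V m. (g B - d)\<^sup>2)"
    define C where "C = (\<Sum>B\<in>ksets V m. \<Sum>y\<in>V - B. ((g B - d) - (f (insert y B) - c))\<^sup>2)"
    have N: "real (Suc m) * N1 = (?n - real m) * N0"
      unfolding N1_def N0_def by (rule card_ksets_Suc) fact
    have cd: "c * N1 + d * N0 = 0"
      using f0 unfolding Suc sum_ksets_insert[OF V] c d g_def by simp
    have norm: "(\<Sum>A\<in>ksets (insert v V) k. (f A)\<^sup>2) = F + G + (c\<^sup>2 * N1 + d\<^sup>2 * N0)"
      unfolding Suc sum_ksets_insert[OF V] F_def G_def using f'(2) g'(2) by (simp add: g_def)
    \<comment> \<open>The incidence between the layers is biregular: each \<open>A\<close> lies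
      above \<open>Suc m\<close> sets and each \<open>B\<close> below \<open>card V - m\<close>.
      Hence mean-free functions remain mean-free when summed over incidences, and the term linear in
      \<open>d - c\<close> drops out of the cross energy.\<close>
    have lin: "(\<Sum>B\<in>ksets V m. \<Sum>y\<in>V - B. (g B - d) - (f (insert y B) - c)) = 0"
    proof -
      have "(\<Sum>B\<in>ksets V m. \<Sum>y\<in>V - B. f (insert y B) - c)
          = (\<Sum>A\<in>ksets V (Suc m). \<Sum>x\<in>A. f A - c)"
        by (rule sum_ksets_Suc[OF V(1), symmetric])
      also have "\<dots> = (\<Sum>A\<in>ksets V (Suc m). real (Suc m) * (f A - c))"
        by (intro sum.cong refl) (simp add: ksetsD)
      also have "\<dots> = 0" by (simp only: sum_distrib_left[symmetric] f'(1) mult_zero_right)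
      finally have 1: "(\<Sum>B\<in>ksets V m. \<Sum>y\<in>V - B. f (insert y B) - c) = 0" .
      have "(\<Sum>B\<in>ksets V m. \<Sum>y\<in>V - B. g B - d) = (\<Sum>B\<in>ksets V m. (?n - real m) * (g B - d))"
        by (intro sum.cong refl) (simp add: card_Diff_ksets[OF V(1)])
      also have "\<dots> = 0" by (simp only: sum_distrib_left[symmetric] g'(1) mult_zero_right)
      finally show ?thesis using 1 by (simp only: sum_subtractf)
    qed
    have "(\<Sum>B\<in>ksets V m. \<Sum>y\<in>V - B. (f (insert v B) - f (insert y B))\<^sup>2)
        = (\<Sum>B\<in>ksets V m. \<Sum>y\<in>V - B. ((g B - d) - (f (insert y B) - c))\<^sup>2
            + 2 * (d - c) * ((g B - d) - (f (insert y B) - c)) + (d - c)\<^sup>2)"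
      by (intro sum.cong refl) (simp add: g_def power2_eq_square algebra_simps)
    also have "\<dots> = C + (\<Sum>B\<in>ksets V m. \<Sum>y\<in>V - B. (d - c)\<^sup>2)"
      by (simp only: sum.distrib sum_distrib_left[symmetric] lin C_def mult_zero_right add_0_right)
    also have "(\<Sum>B\<in>ksets V m. \<Sum>y\<in>V - B. (d - c)\<^sup>2) = (\<Sum>B\<in>ksets V m. (?n - real m) * (d - c)\<^sup>2)"
      by (intro sum.cong refl) (simp add: card_Diff_ksets[OF V(1)])
    also have "\<dots> = (d - c)\<^sup>2 * ((?n - real m) * N0)" by (simp add: N0_def)
    finally have cross: "(\<Sum>B\<in>ksets V m. \<Sum>y\<in>V - B. (f (insert v B) - f (insert y B))\<^sup>2)
        = C + (d - c)\<^sup>2 * ((?n - real m) * N0)" .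
    have energy: "token_energy w (insert v V) k f
        = token_energy w V (Suc m) (\<lambda>A. f A - c) + token_energy w V m (\<lambda>B. g B - d)
          + (C + (d - c)\<^sup>2 * ((?n - real m) * N0))"
      using token_energy_insert[of V v w m f] V w
      by (simp add: Suc token_energy_diff_const cross g_def)
    have "a * F \<le> token_energy w V (Suc m) (\<lambda>A. f A - c)"
      using gap[of "Suc m", unfolded token_gap_def, rule_format, OF f'(1)] by (simp add: F_def)
    moreover have "a * G \<le> token_energy w V m (\<lambda>B. g B - d)"
      using gap[of m, unfolded token_gap_def, rule_format, OF g'(1)] by (simp add: G_def)
    moreover have "F + G \<le> C"
      unfolding F_def G_def C_def using cross_energy_ge[OF V(1) johnson g'(1)] .
    moreover have "(a + 1) * (c\<^sup>2 * N1 + d\<^sup>2 * N0) \<le> (d - c)\<^sup>2 * ((?n - real m) * N0)"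
    proof -
      \<comment> \<open>The function equal to \<open>c\<close> on one layer and \<open>d\<close> on
        the other has mean zero by \<open>cd\<close>. Together with \<open>N\<close> this gives
        \<open>c * (n - m) = - (m + 1) * d\<close>, hence
        \<open>(d - c) * (n - m) = (n + 1) * d\<close>. The derivation cancels \<open>N0\<close>; if
        \<open>N0 = 0\<close>, then \<open>N\<close> makes \<open>N1\<close> vanish too.\<close>
      have "(d - c)\<^sup>2 * ((?n - real m) * N0) = (?n + 1) * (c\<^sup>2 * N1 + d\<^sup>2 * N0)"
      proof (cases "N0 = 0")
        case True
        then show ?thesis using N by simp
      next
        case False
        have cN: "c * N1 = - (d * N0)" using cd by simp
        have "c * (?n - real m) * N0 = real (Suc m) * (c * N1)"
          using N by (simp add: mult_ac)
        then have "c * (?n - real m) * N0 = - (real (Suc m) * d) * N0" by (simp add: cN)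
        then have "c * (?n - real m) = - (real (Suc m) * d)"
          unfolding mult_right_cancel[OF False] .
        then have *: "(d - c) * (?n - real m) = (?n + 1) * d" by (simp add: algebra_simps)
        have "(d - c)\<^sup>2 * ((?n - real m) * N0) = (d - c) * N0 * ((d - c) * (?n - real m))"
          by (simp add: power2_eq_square)
        also have "\<dots> = (?n + 1) * (c * - (d * N0) + d\<^sup>2 * N0)"
          unfolding * by (simp add: power2_eq_square algebra_simps)
        also have "\<dots> = (?n + 1) * (c\<^sup>2 * N1 + d\<^sup>2 * N0)"
          unfolding cN[symmetric] by (simp add: power2_eq_square)
        finally show ?thesis .
      qed
      moreover have "0 \<le> c\<^sup>2 * N1 + d\<^sup>2 * N0" by (simp add: N0_def N1_def)
      ultimately show ?thesis using a by (simp add: mult_right_mono)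
    qed
    ultimately show ?thesis
      unfolding energy norm by (simp add: algebra_simps)
  qed
qed

text \<open>The spectral gap of the Johnson graphs. With constant weight 1 and
  \<open>a = card V\<close>, the two gap hypotheses of \<open>token_gap_insert\<close> coincide, so
  the induction feeds itself.\<close>

lemma token_gap_complete:
  assumes "finite V"
  shows "token_gap (\<lambda>_ _. 1) V k (real (card V))"
  using assms
proof (induction V arbitrary: k)
  case empty
  then show ?case by (simp add: token_gap_0)
next
  case (insert v V)
  then show ?case using token_gap_insert[of V v "\<lambda>_ _. 1" "real (card V)" k]
    by (simp add: add.commute)
qed

text \<open>Starting from the trivial gap 0 on \<open>X\<close>, each inserted vertex of
  \<open>Y\<close> dominates \<open>X\<close> and the vertices of \<open>Y\<close> already present,
  and adds 1 to the gap.\<close>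

lemma token_gap_union_dominating:
  assumes "finite X" "finite Y" "X \<inter> Y = {}" and w: "\<And>x y. 0 \<le> w x y"
    and dom: "\<And>x y. y \<in> Y \<Longrightarrow> x \<in> X \<union> Y \<Longrightarrow> x \<noteq> y \<Longrightarrow> w x y = 1 \<and> w y x = 1"
  shows "token_gap w (X \<union> Y) k (real (card Y))"
  using assms(2,3) dom
proof (induction Y arbitrary: k)
  case empty
  then show ?case using w by (simp add: token_gap_0)
next
  case (insert y Y)
  have "token_gap w (insert y (X \<union> Y)) k (real (card Y) + 1)"
  proof (rule token_gap_insert)
    show "token_gap w (X \<union> Y) k (real (card Y))" for k
      using insert.prems by (intro insert.IH) auto
    show "token_gap (\<lambda>_ _. 1) (X \<union> Y) k (real (card (X \<union> Y)))" for k
      using assms insert.hyps by (intro token_gap_complete) auto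
    show "real (card Y) \<le> real (card (X \<union> Y))"
      using assms insert.hyps by (simp add: card_mono)
    show "w x y = 1" if "x \<in> X \<union> Y" for x
      using insert.prems(2)[of y x] insert.hyps insert.prems(1) that by auto
    show "w y x = 1" if "x \<in> X \<union> Y" for x
      using insert.prems(2)[of y x] insert.hyps insert.prems(1) that by auto
  qed (use assms insert.hyps insert.prems in auto)
  then show ?case using insert.hyps by (simp add: add.commute)
qed

section \<open>The second smallest eigenvalue\<close>

lemma mult_mat_vec_eq_sum:
  assumes "A \<in> carrier_mat n n" "x \<in> carrier_vec n" "i < n"
  shows "(A *\<^sub>v x) $ i = (\<Sum>j<n. A $$ (i, j) * x $ j)"
  using assms by (auto simp: scalar_prod_def atLeast0LessThan intro!: sum.cong)

text \<open>By symmetry the column sums vanish as well, so the image is orthogonal to the all-ones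
  vector.\<close>

lemma sum_mult_mat_vec_eq_0:
  fixes A :: "real mat"
  assumes A: "A \<in> carrier_mat n n" and x: "x \<in> carrier_vec n"
    and sym: "\<And>i j. i < n \<Longrightarrow> j < n \<Longrightarrow> A $$ (i, j) = A $$ (j, i)"
    and row: "\<And>i. i < n \<Longrightarrow> (\<Sum>j<n. A $$ (i, j)) = 0"
  shows "(\<Sum>i<n. (A *\<^sub>v x) $ i) = 0"
proof -
  have "(\<Sum>i<n. (A *\<^sub>v x) $ i) = (\<Sum>i<n. \<Sum>j<n. A $$ (i, j) * x $ j)"
    by (intro sum.cong) (auto simp: mult_mat_vec_eq_sum[OF A x])
  also have "\<dots> = (\<Sum>j<n. \<Sum>i<n. A $$ (i, j) * x $ j)" by (rule sum.swap)
  also have "\<dots> = (\<Sum>j<n. (\<Sum>i<n. A $$ (j, i)) * x $ j)"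
    unfolding sum_distrib_right by (intro sum.cong refl) (simp add: sym)
  also have "\<dots> = 0" by (simp add: row)
  finally show ?thesis .
qed

text \<open>The change of basis replacing the first unit vector by the all-ones vector splits off
  the eigenvalue 0.\<close>

lemma char_poly_row_sums_0:
  fixes A :: "real mat"
  assumes A: "A \<in> carrier_mat (Suc m) (Suc m)"
    and row: "\<And>i. i < Suc m \<Longrightarrow> (\<Sum>j<Suc m. A $$ (i, j)) = 0"
  shows "char_poly A
       = [:0, 1:] * char_poly (mat m m (\<lambda>(i, j). A $$ (Suc i, Suc j) - A $$ (0, Suc j)))"
proof -
  let ?n = "Suc m"
  define P where "P = mat ?n ?n (\<lambda>(i, j). (if j = i then 1 else 0)
    + (if j = 0 then if i = 0 then 0 else 1 else (0::real)))"
  define Q where "Q = mat ?n ?n (\<lambda>(i, j). (if j = i then 1 else 0)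
    - (if j = 0 then if i = 0 then 0 else 1 else (0::real)))"
  define B where "B = mat m m (\<lambda>(i, j). A $$ (Suc i, Suc j) - A $$ (0, Suc j))"
  \<comment> \<open>This is \<open>Q * A * P\<close>: its first column is zero because
    \<open>A\<close> kills the all-ones vector, and multiplication by \<open>Q\<close> from the left
    subtracts row 0 from all other rows.\<close>
  define M where "M = four_block_mat (0\<^sub>m 1 1) (mat 1 m (\<lambda>(i, j). A $$ (0, Suc j))) (0\<^sub>m m 1) B"
  have carr: "P \<in> carrier_mat ?n ?n" "Q \<in> carrier_mat ?n ?n" "M \<in> carrier_mat ?n ?n"
    by (auto simp: P_def Q_def M_def B_def)
  have M: "M $$ (i, j) = (if j = 0 then 0 else if i = 0 then A $$ (0, j) else A $$ (i, j) - A $$ (0, j))"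
    if "i < ?n" "j < ?n" for i j
    using that by (auto simp: M_def B_def)
  have Pm: "(P * X) $$ (i, j) = X $$ (i, j) + (if i = 0 then 0 else X $$ (0, j))"
    if "X \<in> carrier_mat ?n ?n" "i < ?n" "j < ?n" for X i j
  proof -
    have "(P * X) $$ (i, j) = (\<Sum>l = 0..<?n. (if l = i then X $$ (l, j) else 0)
        + (if l = 0 then if i = 0 then 0 else X $$ (l, j) else 0))"
      using that by (auto simp: P_def scalar_prod_def intro!: sum.cong simp del: sum.op_ivl_Suc)
    then show ?thesis using that by (simp add: sum.distrib sum.delta del: sum.op_ivl_Suc)
  qed
  have Qm: "(Q * X) $$ (i, j) = X $$ (i, j) - (if i = 0 then 0 else X $$ (0, j))"
    if "X \<in> carrier_mat ?n ?n" "i < ?n" "j < ?n" for X i j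
  proof -
    have "(Q * X) $$ (i, j) = (\<Sum>l = 0..<?n. (if l = i then X $$ (l, j) else 0)
        - (if l = 0 then if i = 0 then 0 else X $$ (l, j) else 0))"
      using that by (auto simp: Q_def scalar_prod_def intro!: sum.cong simp del: sum.op_ivl_Suc)
    then show ?thesis using that by (simp add: sum_subtractf sum.delta del: sum.op_ivl_Suc)
  qed
  have PQ: "P * Q = 1\<^sub>m ?n"
  proof (rule eq_matI)
    fix i j assume "i < dim_row (1\<^sub>m ?n)" "j < dim_col (1\<^sub>m ?n)"
    then show "(P * Q) $$ (i, j) = 1\<^sub>m ?n $$ (i, j)"
      using Pm[OF carr(2), of i j] by (simp add: Q_def)
  qed (use carr in auto)
  have QP: "Q * P = 1\<^sub>m ?n"
  proof (rule eq_matI)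
    fix i j assume "i < dim_row (1\<^sub>m ?n)" "j < dim_col (1\<^sub>m ?n)"
    then show "(Q * P) $$ (i, j) = 1\<^sub>m ?n $$ (i, j)"
      using Qm[OF carr(1), of i j] by (simp add: P_def)
  qed (use carr in auto)
  have AP: "A * P = P * M"
  proof (rule eq_matI)
    fix i j assume "i < dim_row (P * M)" "j < dim_col (P * M)"
    then have ij: "i < ?n" "j < ?n" using carr by auto
    have "(A * P) $$ (i, j) = (\<Sum>l<?n. A $$ (i, l) * P $$ (l, j))"
      using ij A carr by (auto simp: scalar_prod_def atLeast0LessThan intro!: sum.cong)
    also have "\<dots> = (if j = 0 then 0 else A $$ (i, j))"
    proof (cases "j = 0")
      case True
      have "(\<Sum>l<?n. A $$ (i, l) * P $$ (l, j)) = (\<Sum>l<?n. A $$ (i, l))"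
        by (intro sum.cong) (auto simp: P_def True)
      then show ?thesis using row[OF ij(1)] True by simp
    next
      case False
      then have "(\<Sum>l<?n. A $$ (i, l) * P $$ (l, j)) = (\<Sum>l<?n. if j = l then A $$ (i, l) else 0)"
        using ij by (intro sum.cong) (auto simp: P_def)
      then show ?thesis using False ij by (simp add: sum.delta del: sum.lessThan_Suc)
    qed
    also have "\<dots> = (P * M) $$ (i, j)"
      using ij by (simp add: Pm[OF carr(3)] M del: index_mult_mat(1))
    finally show "(A * P) $$ (i, j) = (P * M) $$ (i, j)" .
  qed (use A carr in auto)
  have "A = A * (P * Q)" using PQ A by simp
  also have "\<dots> = P * M * Q" using A carr AP by (simp flip: assoc_mult_mat)
  finally have "similar_mat_wit A M P Q"
    using A carr PQ QP by (auto simp: similar_mat_wit_def Let_def)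
  then have "char_poly A = char_poly M" by (intro char_poly_similar) (auto simp: similar_mat_def)
  also have "\<dots> = char_poly (0\<^sub>m 1 1) * char_poly B"
    unfolding M_def by (rule char_poly_four_block_zeros_col) (auto simp: B_def)
  also have "char_poly (0\<^sub>m 1 1 :: real mat) = [:0, 1:]"
    by (simp add: char_poly_defs det_def sign_def)
  finally show ?thesis by (simp add: B_def)
qed

lemma nth_1_sorted_list_of_multiset:
  fixes a b :: "'a :: linorder"
  assumes "b \<in># M" "a \<le> b" "\<And>x. x \<in># M \<Longrightarrow> b \<le> x"
  shows "sorted_list_of_multiset (add_mset a M) ! 1 = b"
proof -
  define xs where "xs = sorted_list_of_multiset M"
  have xs: "set xs = set_mset M" "sorted xs" by (auto simp: xs_def)
  then have "sorted_list_of_multiset (add_mset a M) = a # xs"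
    using assms by (auto simp: xs_def[symmetric] intro!: insort_is_Cons dest: order.trans)
  moreover have "xs ! 0 = b"
  proof (cases xs)
    case Nil
    then show ?thesis using xs assms by auto
  next
    case (Cons y ys)
    then have "y \<in># M" "b \<in> set (y # ys)" using xs assms(1) by auto
    then have "y \<le> b" "b \<le> y" using xs Cons assms(3) by auto
    then show ?thesis using Cons by simp
  qed
  ultimately show ?thesis by simp
qed

text \<open>A variational criterion that avoids diagonalization. One root 0 is split off the
  characteristic polynomial; the remaining roots are eigenvalues of a smaller matrix
  \<open>B\<close>. The gap bounds every nonzero eigenvalue below by \<open>a\<close>, and 0 is not
  an eigenvalue of \<open>B\<close>, so \<open>a\<close> is the least remaining root.\<close>

lemma eigenvalue_list_nth_1:
  fixes A :: "real mat"
  assumes A: "A \<in> carrier_mat n n"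
    and sym: "\<And>i j. i < n \<Longrightarrow> j < n \<Longrightarrow> A $$ (i, j) = A $$ (j, i)"
    and row: "\<And>i. i < n \<Longrightarrow> (\<Sum>j<n. A $$ (i, j)) = 0"
    and a: "a > 0" "eigenvalue A a"
    and gap: "\<And>x. x \<in> carrier_vec n \<Longrightarrow> (\<Sum>i<n. x $ i) = 0 \<Longrightarrow>
                a * (\<Sum>i<n. (x $ i)\<^sup>2) \<le> (\<Sum>i<n. x $ i * (A *\<^sub>v x) $ i)"
  shows "eigenvalue_list A ! 1 = a"
proof -
  \<comment> \<open>An eigenvector for a nonzero eigenvalue lies in the image of \<open>A\<close>,
    hence has coordinate sum 0, and the gap applies to it.\<close>
  have ge: "a \<le> e" if e: "eigenvalue A e" "e \<noteq> 0" for e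
  proof -
    obtain x where x: "x \<in> carrier_vec n" "x \<noteq> 0\<^sub>v n" "A *\<^sub>v x = e \<cdot>\<^sub>v x"
      using e A by (auto simp: eigenvalue_def eigenvector_def)
    have "(\<Sum>i<n. (e \<cdot>\<^sub>v x) $ i) = 0"
      using sum_mult_mat_vec_eq_0[OF A x(1) sym row] x(3) by simp
    then have "e * (\<Sum>i<n. x $ i) = 0" using x(1) by (simp add: sum_distrib_left)
    then have "(\<Sum>i<n. x $ i) = 0" using e by simp
    from gap[OF x(1) this] have "a * (\<Sum>i<n. (x $ i)\<^sup>2) \<le> (\<Sum>i<n. x $ i * (e * x $ i))"
      using x(1) by (simp add: x(3))
    also have "\<dots> = e * (\<Sum>i<n. (x $ i)\<^sup>2)"
      by (simp add: sum_distrib_left power2_eq_square mult_ac)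
    finally have le: "a * (\<Sum>i<n. (x $ i)\<^sup>2) \<le> e * (\<Sum>i<n. (x $ i)\<^sup>2)" .
    obtain i where "i < n" "x $ i \<noteq> 0" using x by (metis carrier_vecD eq_vecI index_zero_vec)
    then have "0 < (\<Sum>i<n. (x $ i)\<^sup>2)" by (intro sum_pos2[of _ i]) auto
    with le show ?thesis by simp
  qed
  \<comment> \<open>The kernel consists of constant vectors: subtracting the mean \<open>t\<close>
    stays in the kernel, and there the gap forces the mean-free remainder to vanish.\<close>
  have ker: "x $ i = x $ j" if x: "x \<in> carrier_vec n" "A *\<^sub>v x = 0\<^sub>v n" and ij: "i < n" "j < n" for x i j
  proof -
    define t where "t = (\<Sum>i<n. x $ i) / real n"
    define z where "z = vec n (\<lambda>i. x $ i - t)"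
    have z: "z \<in> carrier_vec n" "(\<Sum>i<n. z $ i) = 0"
      using ij by (auto simp: z_def t_def sum_subtractf)
    have "(A *\<^sub>v z) $ i = 0" if "i < n" for i
    proof -
      have "(A *\<^sub>v z) $ i = (\<Sum>j<n. A $$ (i, j) * x $ j - A $$ (i, j) * t)"
        unfolding mult_mat_vec_eq_sum[OF A z(1) that]
        by (intro sum.cong) (auto simp: z_def algebra_simps)
      also have "\<dots> = (A *\<^sub>v x) $ i - (\<Sum>j<n. A $$ (i, j)) * t"
        by (simp add: sum_subtractf mult_mat_vec_eq_sum[OF A x(1) that] sum_distrib_right)
      finally show ?thesis using row[OF that] x that by simp
    qed
    then have "a * (\<Sum>i<n. (z $ i)\<^sup>2) \<le> 0" using gap[OF z] by simp
    then have "(\<Sum>i<n. (z $ i)\<^sup>2) \<le> 0" using a by (simp add: mult_le_0_iff)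
    then have "(\<Sum>i<n. (z $ i)\<^sup>2) = 0" by (intro antisym sum_nonneg) auto
    then have "z $ l = 0" if "l < n" for l using that by (subst (asm) sum_nonneg_eq_0_iff) auto
    then show ?thesis using ij by (simp add: z_def)
  qed
  obtain x0 :: "real vec" where "x0 \<in> carrier_vec n" "x0 \<noteq> 0\<^sub>v n"
    using a(2) A unfolding eigenvalue_def eigenvector_def by auto
  then obtain m where n: "n = Suc m" by (cases n) auto
  define B where "B = mat m m (\<lambda>(i, j). A $$ (Suc i, Suc j) - A $$ (0, Suc j))"
  have B: "B \<in> carrier_mat m m" by (simp add: B_def)
  have cp: "char_poly A = [:0, 1:] * char_poly B"
    unfolding B_def using char_poly_row_sums_0[of A m] A row n by blast
  \<comment> \<open>This excludes a second root 0, where a one-dimensional kernel of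
    \<open>A\<close> alone does not bound the algebraic multiplicity. A kernel vector
    \<open>u\<close> of \<open>B\<close>, extended by 0 in coordinate 0, has constant image under
    \<open>A\<close>; that image sums to 0, so it is zero. By \<open>ker\<close> the extension is
    constant, hence zero.\<close>
  have B0: "\<not> eigenvalue B 0"
  proof
    assume "eigenvalue B 0"
    then obtain u where u: "u \<in> carrier_vec m" "u \<noteq> 0\<^sub>v m" "B *\<^sub>v u = 0 \<cdot>\<^sub>v u"
      using B by (auto simp: eigenvalue_def eigenvector_def)
    define x where "x = vec n (\<lambda>i. if i = 0 then 0 else u $ (i - 1))"
    have x: "x \<in> carrier_vec n" by (simp add: x_def)
    have Ax: "(A *\<^sub>v x) $ i = (\<Sum>j<m. A $$ (i, Suc j) * u $ j)" if "i < n" for i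
      unfolding mult_mat_vec_eq_sum[OF A x that] unfolding n sum.lessThan_Suc_shift
      by (simp add: x_def n)
    have eq: "(A *\<^sub>v x) $ i = (A *\<^sub>v x) $ 0" if "i < n" for i
    proof (cases i)
      case (Suc l)
      then have l: "l < m" using that n by simp
      have "(\<Sum>j<m. B $$ (l, j) * u $ j) = 0"
        using mult_mat_vec_eq_sum[OF B u(1) l] u l by simp
      then have "(\<Sum>j<m. A $$ (Suc l, Suc j) * u $ j - A $$ (0, Suc j) * u $ j) = 0"
        using l by (simp add: B_def left_diff_distrib)
      then show ?thesis using Ax[OF that] Ax[of 0] n Suc by (simp add: sum_subtractf)
    qed simp
    have "0 = (\<Sum>i<n. (A *\<^sub>v x) $ i)" using sum_mult_mat_vec_eq_0[OF A x sym row] by simp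
    also have "\<dots> = (\<Sum>i<n. (A *\<^sub>v x) $ 0)" by (intro sum.cong refl) (rule eq, simp)
    finally have "(A *\<^sub>v x) $ 0 = 0" using n by simp
    then have "(A *\<^sub>v x) $ i = 0" if "i < n" for i using eq[OF that] by simp
    then have "A *\<^sub>v x = 0\<^sub>v n" using A by (intro eq_vecI) auto
    then have "x $ Suc l = x $ 0" if "l < m" for l using ker[OF x] that n by simp
    then have "u $ l = 0" if "l < m" for l using that n by (simp add: x_def)
    then show False using u by (metis carrier_vecD eq_vecI index_zero_vec)
  qed
  have nz: "char_poly A \<noteq> 0" "char_poly B \<noteq> 0"
    using degree_monic_char_poly[OF A] degree_monic_char_poly[OF B] by auto
  have roots: "x \<in># proots (char_poly B) \<longleftrightarrow> eigenvalue B x" for x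
    using nz by (simp add: eigenvalue_root_char_poly[OF B])
  have eig: "eigenvalue A x \<longleftrightarrow> x = 0 \<or> eigenvalue B x" for x
    unfolding eigenvalue_root_char_poly[OF A] eigenvalue_root_char_poly[OF B] cp by simp
  have proots: "proots (char_poly A) = add_mset 0 (proots (char_poly B))"
    unfolding cp using nz by (subst proots_mult) (auto simp: proots_linear_factor[of 0, simplified])
  have "b \<ge> a" if "b \<in># proots (char_poly B)" for b
    using that B0 ge eig by (auto simp: roots)
  moreover have "a \<in># proots (char_poly B)" using a eig by (auto simp: roots)
  ultimately show ?thesis
    unfolding eigenvalue_list_def proots using a(1) by (intro nth_1_sorted_list_of_multiset) auto
qed

section \<open>The Laplacian as a difference operator and its quadratic form\<close>

lemma out_degree_with_proj: "out_degree (with_proj G) u = card {v. (u, v) \<in> parcs G}"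
proof -
  have "out_arcs (with_proj G) u = Pair u ` {v. (u, v) \<in> parcs G}"
    by (auto simp: out_arcs_def)
  then show ?thesis by (simp add: out_degree_def card_image inj_on_def)
qed

lemma laplacian_mat_mult:
  assumes G: "pair_graph G" and vs: "distinct vs" "set vs = pverts G" and i: "i < length vs"
  shows "(\<Sum>j<length vs. laplacian_mat G vs $$ (i, j) * f (vs ! j))
       = (\<Sum>v | (vs ! i, v) \<in> parcs G. f (vs ! i) - f v)"
proof -
  interpret pair_graph G by fact
  let ?u = "vs ! i"
  let ?N = "{v. (?u, v) \<in> parcs G}"
  have N: "?N \<subseteq> pverts G" by (auto dest: in_arcsD2)
  have fin: "finite (pverts G)" by simp
  have "(\<Sum>j<length vs. laplacian_mat G vs $$ (i, j) * f (vs ! j))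
      = (\<Sum>j = 0..<length vs. (\<lambda>v. (if v = ?u then real (card ?N) * f v else 0)
          - (if v \<in> ?N then f v else 0)) (vs ! j))"
    using vs i by (auto simp: laplacian_mat_def out_degree_with_proj nth_eq_iff_index_eq
        left_diff_distrib atLeast0LessThan intro!: sum.cong)
  also have "\<dots> = (\<Sum>v\<in>pverts G. (if v = ?u then real (card ?N) * f v else 0)
      - (if v \<in> ?N then f v else 0))"
    unfolding vs(2)[symmetric] by (rule sum_nth_distinct) fact
  also have "\<dots> = real (card ?N) * f ?u - (\<Sum>v\<in>?N. f v)"
  proof -
    have "?u \<in> pverts G" using vs i by auto
    moreover have "(\<Sum>v\<in>pverts G. if v \<in> ?N then f v else 0) = (\<Sum>v\<in>?N. f v)"
      using N fin by (simp only: sum.inter_restrict[symmetric] Int_absorb1)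
    ultimately show ?thesis using fin by (simp add: sum_subtractf)
  qed
  finally show ?thesis by (simp add: sum_subtractf)
qed

text \<open>Summation by parts: reversing all arcs preserves the sum, and averaging the two versions
  yields squares.\<close>

lemma sum_laplacian_form:
  fixes f :: "'a \<Rightarrow> real"
  assumes "pair_graph G"
  shows "(\<Sum>u\<in>pverts G. f u * (\<Sum>v | (u, v) \<in> parcs G. f u - f v))
       = (\<Sum>u\<in>pverts G. \<Sum>v | (u, v) \<in> parcs G. (f u - f v)\<^sup>2) / 2"
proof -
  interpret pair_graph G by fact
  have arcs: "parcs G = Sigma (pverts G) (\<lambda>u. {v. (u, v) \<in> parcs G})"
    by (auto dest: in_arcsD1)
  have fin: "finite {v. (u, v) \<in> parcs G}" for u
    by (rule finite_subset[of _ "pverts G"]) (auto dest: in_arcsD2)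
  have Sig: "(\<Sum>u\<in>pverts G. \<Sum>v | (u, v) \<in> parcs G. h u v) = (\<Sum>(u, v)\<in>parcs G. h u v)"
    for h :: "'a \<Rightarrow> 'a \<Rightarrow> real"
    by (subst (2) arcs, rule sum.Sigma) (use fin in auto)
  let ?S = "\<Sum>(u, v)\<in>parcs G. f u * (f u - f v)"
  have "?S = (\<Sum>(u, v)\<in>parcs G. f v * (f v - f u))"
    by (rule sum.reindex_bij_witness[of _ prod.swap prod.swap])
      (use sym_arcs in \<open>auto simp: symmetric_def dest: symD\<close>)
  then have "2 * ?S = (\<Sum>(u, v)\<in>parcs G. f u * (f u - f v)) + (\<Sum>(u, v)\<in>parcs G. f v * (f v - f u))"
    by simp
  also have "\<dots> = (\<Sum>(u, v)\<in>parcs G. (f u - f v)\<^sup>2)"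
    unfolding sum.distrib[symmetric]
    by (intro sum.cong) (auto simp: power2_eq_square algebra_simps)
  finally have "2 * ?S = (\<Sum>(u, v)\<in>parcs G. (f u - f v)\<^sup>2)" .
  moreover have "(\<Sum>u\<in>pverts G. f u * (\<Sum>v | (u, v) \<in> parcs G. f u - f v)) = ?S"
    by (simp only: sum_distrib_left Sig)
  ultimately show ?thesis by (simp add: Sig)
qed

text \<open>Translates the matrix criterion to functions on vertices: the gap supplies the lower
  bound and the eigenfunction \<open>\<phi>\<close> shows that \<open>a\<close> is attained.\<close>

lemma algebraic_connectivity_eqI:
  fixes a :: real
  assumes G: "pair_graph G" and a: "a > 0"
    and gap: "\<And>f. (\<Sum>u\<in>pverts G. f u) = 0 \<Longrightarrow>
      a * (\<Sum>u\<in>pverts G. (f u)\<^sup>2) \<le> (\<Sum>u\<in>pverts G. \<Sum>v | (u, v) \<in> parcs G. (f u - f v)\<^sup>2) / 2"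
    and eig: "\<And>u. u \<in> pverts G \<Longrightarrow> (\<Sum>v | (u, v) \<in> parcs G. \<phi> u - \<phi> v) = a * \<phi> u"
    and nz: "u0 \<in> pverts G" "\<phi> u0 \<noteq> 0"
  shows "algebraic_connectivity G = a"
proof -
  interpret pair_graph G by fact
  obtain vs where vs: "distinct vs" "set vs = pverts G"
    using finite_distinct_list[of "pverts G"] by auto
  define L where "L = laplacian_mat G vs"
  define n where "n = length vs"
  note mult = laplacian_mat_mult[OF G vs, folded L_def n_def]
  have L: "L \<in> carrier_mat n n" by (simp add: L_def n_def laplacian_mat_def)
  have sum_vs: "(\<Sum>i<n. h (vs ! i)) = (\<Sum>u\<in>pverts G. h u)" for h :: "'a \<Rightarrow> real"
    using sum_nth_distinct[OF vs(1), of h] by (simp add: vs n_def atLeast0LessThan)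
  have "eigenvalue_list L ! 1 = a"
  proof (rule eigenvalue_list_nth_1[OF L _ _ a])
    show "L $$ (i, j) = L $$ (j, i)" if "i < n" "j < n" for i j
      using that sym_arcs
      by (auto simp: L_def laplacian_mat_def n_def symmetric_def dest: symD)
    show "(\<Sum>j<n. L $$ (i, j)) = 0" if "i < n" for i
      using mult[OF that, of "\<lambda>_. 1"] by simp
    show "eigenvalue L a"
      unfolding eigenvalue_def eigenvector_def
    proof (intro exI conjI)
      let ?x = "vec n (\<lambda>i. \<phi> (vs ! i))"
      show x: "?x \<in> carrier_vec (dim_row L)" using L by simp
      obtain i where i: "i < n" "vs ! i = u0"
        using nz(1) unfolding vs(2)[symmetric] n_def in_set_conv_nth by blast
      show "?x \<noteq> 0\<^sub>v (dim_row L)"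
      proof
        assume "?x = 0\<^sub>v (dim_row L)"
        then have "?x $ i = 0" using i L by simp
        then show False using i nz by simp
      qed
      show "L *\<^sub>v ?x = a \<cdot>\<^sub>v ?x"
      proof (rule eq_vecI)
        fix i assume "i < dim_vec (a \<cdot>\<^sub>v ?x)"
        then have i: "i < n" by simp
        then have "vs ! i \<in> pverts G" using vs by (auto simp: n_def)
        then show "(L *\<^sub>v ?x) $ i = (a \<cdot>\<^sub>v ?x) $ i"
          using mult[OF i, of \<phi>] eig i by (simp add: mult_mat_vec_eq_sum[OF L _ i])
      qed (use L in simp)
    qed
    fix x :: "real vec" assume x: "x \<in> carrier_vec n" "(\<Sum>i<n. x $ i) = 0"
    \<comment> \<open>The inverse of the enumeration \<open>vs\<close> turns a coordinate vector
      into a function on vertices.\<close>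
    define f where "f u = x $ (the_inv_into {..<n} ((!) vs) u)" for u
    have f: "x $ i = f (vs ! i)" if "i < n" for i
      using that vs by (simp add: f_def the_inv_into_f_f inj_on_nth n_def)
    have "(\<Sum>u\<in>pverts G. f u) = 0"
      using x(2) by (simp add: f sum_vs)
    from gap[OF this] have "a * (\<Sum>i<n. (x $ i)\<^sup>2)
        \<le> (\<Sum>u\<in>pverts G. f u * (\<Sum>v | (u, v) \<in> parcs G. f u - f v))"
      by (simp add: f sum_vs[of "\<lambda>u. (f u)\<^sup>2"] sum_laplacian_form[OF G])
    also have "\<dots> = (\<Sum>i<n. x $ i * (L *\<^sub>v x) $ i)"
      unfolding sum_vs[symmetric]
      by (intro sum.cong refl) (simp add: mult_mat_vec_eq_sum[OF L x(1)] f mult[symmetric])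
    finally show "a * (\<Sum>i<n. (x $ i)\<^sup>2) \<le> (\<Sum>i<n. x $ i * (L *\<^sub>v x) $ i)" .
  qed
  then show ?thesis using algebraic_connectivity_eq[OF vs] by (simp add: L_def)
qed

section \<open>Laplacians of token graphs\<close>

definition arc_weight :: "'a pair_pre_digraph \<Rightarrow> 'a \<Rightarrow> 'a \<Rightarrow> real" where
  "arc_weight G x y = (if (x, y) \<in> parcs G then 1 else 0)"

lemma pverts_token_graph: "pverts (token_graph k G) = ksets (pverts G) k"
  by (simp add: token_graph_def ksets_def)

text \<open>For two sets of equal finite size, both one-sided differences have the same cardinality.
  A symmetric difference of two elements therefore consists of one removed and one added vertex: a
  neighbour arises by moving one token along an edge.\<close>

lemma token_graph_neighbours:
  assumes G: "pair_graph G" and A: "A \<in> ksets (pverts G) k"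
  shows "{B. (A, B) \<in> parcs (token_graph k G)}
       = (\<lambda>(x, y). insert y (A - {x})) ` {(x, y). x \<in> A \<and> y \<in> pverts G - A \<and> (x, y) \<in> parcs G}"
    (is "?L = ?f ` ?T")
proof (intro equalityI subsetI)
  interpret pair_graph G by fact
  have fin: "finite (pverts G)" by simp
  {
    fix B assume "B \<in> ?L"
    then obtain a b where B: "B \<in> ksets (pverts G) k" and ab: "sym_diff A B = {a, b}" "(a, b) \<in> parcs G"
      unfolding token_graph_def ksets_def Let_def by auto
    have ne: "a \<noteq> b" using ab(2) no_loops' by auto
    have ba: "(b, a) \<in> parcs G" using ab(2) sym_arcs by (auto simp: symmetric_def dest: symD)
    have fAB: "finite A" "finite B" using A B finite_ksets_member[OF fin] by auto
    have card: "card (A - B) = card (B - A)"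
      using fAB A B card_Diff_subset_Int[of A B] card_Diff_subset_Int[of B A]
      by (simp add: ksetsD Int_commute)
    have *: "B = ?f (x, y) \<and> (x, y) \<in> ?T"
      if "x \<in> A - B" "y \<in> B - A" "sym_diff A B = {x, y}" "(x, y) \<in> parcs G" for x y
      using that ksetsD(1)[OF B] by auto
    \<comment> \<open>The definition of adjacency does not say which of \<open>a\<close> and
      \<open>b\<close> is removed. The second case uses symmetry of \<open>G\<close>; the last two
      contradict equality of the cardinalities.\<close>
    consider "a \<in> A - B" "b \<in> B - A" | "b \<in> A - B" "a \<in> B - A" | "{a, b} \<subseteq> A - B" | "{a, b} \<subseteq> B - A"
      using ab(1) by blast
    then show "B \<in> ?f ` ?T"
    proof cases
      case 1
      then show ?thesis using *[OF 1 ab] by blast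
    next
      case 2
      have "sym_diff A B = {b, a}" using ab(1) by (subst insert_commute)
      then show ?thesis using *[OF 2 _ ba] by blast
    next
      case 3
      then have eqs: "A - B = {a, b}" "B - A = {}" using ab(1) by blast+
      show ?thesis using card[unfolded eqs] ne by simp
    next
      case 4
      then have eqs: "B - A = {a, b}" "A - B = {}" using ab(1) by blast+
      show ?thesis using card[unfolded eqs] ne by simp
    qed
  }
  fix B assume "B \<in> ?f ` ?T"
  then obtain x y where xy: "x \<in> A" "y \<in> pverts G - A" "(x, y) \<in> parcs G" "B = insert y (A - {x})"
    by auto
  have "finite A" using finite_ksets_member[OF fin A] .
  then have "card B = card A"
    using xy by (metis DiffD1 DiffD2 card_Suc_Diff1 card_insert_disjoint finite_Diff)
  moreover have "B \<subseteq> pverts G" using xy ksetsD(1)[OF A] by auto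
  moreover have "sym_diff A B = {x, y}" using xy by auto
  ultimately show "B \<in> ?L"
    using A xy(3) unfolding token_graph_def ksets_def Let_def by auto
qed

text \<open>A neighbour determines its move, since the old and the new position can be read off from
  the two one-sided differences. This links the Laplacian sums of the token graph to
  \<open>token_energy\<close>.\<close>

lemma sum_token_graph_neighbours:
  fixes h :: "'a set \<Rightarrow> real"
  assumes G: "pair_graph G" and A: "A \<in> ksets (pverts G) k"
  shows "(\<Sum>B | (A, B) \<in> parcs (token_graph k G). h B)
       = (\<Sum>x\<in>A. \<Sum>y\<in>pverts G - A. arc_weight G x y * h (insert y (A - {x})))"
proof -
  interpret pair_graph G by fact
  let ?T = "{(x, y). x \<in> A \<and> y \<in> pverts G - A \<and> (x, y) \<in> parcs G}"
  have fin: "finite (pverts G)" "finite A" using finite_ksets_member[OF _ A] by auto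
  have inj: "inj_on (\<lambda>(x, y). insert y (A - {x})) ?T"
  proof (rule inj_onI, clarify)
    fix x y x' y'
    assume "x \<in> A" "y \<notin> A" "x' \<in> A" "y' \<notin> A" and eq: "insert y (A - {x}) = insert y' (A - {x'})"
    moreover have "y \<in> insert y' (A - {x'})" "x \<notin> insert y' (A - {x'})"
      unfolding eq[symmetric] using \<open>x \<in> A\<close> \<open>y \<notin> A\<close> by auto
    ultimately show "x = x' \<and> y = y'" by auto
  qed
  have "(\<Sum>B | (A, B) \<in> parcs (token_graph k G). h B) = (\<Sum>(x, y)\<in>?T. h (insert y (A - {x})))"
    unfolding token_graph_neighbours[OF G A] by (subst sum.reindex[OF inj]) (simp add: case_prod_unfold)
  also have "\<dots> = (\<Sum>(x, y)\<in>A \<times> (pverts G - A). arc_weight G x y * h (insert y (A - {x})))"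
    using fin by (intro sum.mono_neutral_cong_left) (auto simp: arc_weight_def split: if_splits)
  also have "\<dots> = (\<Sum>x\<in>A. \<Sum>y\<in>pverts G - A. arc_weight G x y * h (insert y (A - {x})))"
    using fin by (intro sum.cartesian_product[symmetric])
  finally show ?thesis .
qed

lemma sum_neighbours_arc_weight:
  fixes h :: "'a \<Rightarrow> real"
  assumes "pair_graph G"
  shows "(\<Sum>v | (u, v) \<in> parcs G. h v) = (\<Sum>v\<in>pverts G. arc_weight G u v * h v)"
proof -
  interpret pair_graph G by fact
  show ?thesis
    by (rule sum.mono_neutral_cong_left) (auto simp: arc_weight_def dest: in_arcsD2)
qed

text \<open>The lift works because the contributions of pairs inside \<open>A\<close> cancel by antisymmetry.\<close>

lemma token_graph_eigenfunction:
  fixes \<phi> :: "'a \<Rightarrow> real"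
  assumes G: "pair_graph G" and A: "A \<in> ksets (pverts G) k"
    and eig: "\<And>u. u \<in> pverts G \<Longrightarrow> (\<Sum>v | (u, v) \<in> parcs G. \<phi> u - \<phi> v) = a * \<phi> u"
  shows "(\<Sum>B | (A, B) \<in> parcs (token_graph k G). sum \<phi> A - sum \<phi> B) = a * sum \<phi> A"
proof -
  interpret pair_graph G by fact
  let ?V = "pverts G"
  let ?t = "\<lambda>x y. arc_weight G x y * (\<phi> x - \<phi> y)"
  have fin: "finite ?V" "finite A" and sub: "A \<subseteq> ?V" using finite_ksets_member[OF _ A] ksetsD(1)[OF A] by auto
  have "(\<Sum>x\<in>A. \<Sum>y\<in>A. ?t x y) = (\<Sum>x\<in>A. \<Sum>y\<in>A. - ?t x y)"
  proof (subst sum.swap, intro sum.cong refl)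
    fix x y show "?t y x = - ?t x y"
      using sym_arcs by (auto simp: arc_weight_def symmetric_def dest: symD)
  qed
  then have inner: "(\<Sum>x\<in>A. \<Sum>y\<in>A. ?t x y) = 0" by (simp add: sum_negf)
  \<comment> \<open>Moving a token from \<open>x\<close> to \<open>y\<close> changes the sum of
    \<open>\<phi>\<close> over the token set by \<open>\<phi> x - \<phi> y\<close>.\<close>
  have "(\<Sum>B | (A, B) \<in> parcs (token_graph k G). sum \<phi> A - sum \<phi> B) = (\<Sum>x\<in>A. \<Sum>y\<in>?V - A. ?t x y)"
    unfolding sum_token_graph_neighbours[OF G A]
  proof (intro sum.cong refl)
    fix x y assume "x \<in> A" "y \<in> ?V - A"
    then show "arc_weight G x y * (sum \<phi> A - sum \<phi> (insert y (A - {x}))) = ?t x y"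
      using fin by (simp add: sum_diff1)
  qed
  also have "\<dots> = (\<Sum>x\<in>A. \<Sum>y\<in>?V - A. ?t x y) + (\<Sum>x\<in>A. \<Sum>y\<in>A. ?t x y)"
    by (simp add: inner)
  also have "\<dots> = (\<Sum>x\<in>A. \<Sum>y\<in>?V. ?t x y)"
    unfolding sum.distrib[symmetric] by (intro sum.cong refl sum.subset_diff[symmetric] sub fin)
  also have "\<dots> = (\<Sum>x\<in>A. a * \<phi> x)"
    using sub eig by (intro sum.cong refl) (auto simp: sum_neighbours_arc_weight[OF G, symmetric])
  finally show ?thesis by (simp add: sum_distrib_left)
qed

text \<open>An eigenfunction of \<open>G\<close> lifts to the token graph by summing over token
  sets. It remains to see that the lift is not identically zero, for which \<open>\<phi>\<close> has
  to separate two vertices.\<close>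

lemma algebraic_connectivity_token_graph_eqI:
  fixes G :: "'a pair_pre_digraph" and a :: real
  assumes G: "pair_graph G" and a: "a > 0" and gap: "token_gap (arc_weight G) (pverts G) k a"
    and eig: "\<And>u. u \<in> pverts G \<Longrightarrow> (\<Sum>v | (u, v) \<in> parcs G. \<phi> u - \<phi> v) = a * \<phi> u"
    and pq: "p \<in> pverts G" "q \<in> pverts G" "\<phi> p \<noteq> \<phi> q"
    and k: "1 \<le> k" "k \<le> card (pverts G) - 1"
  shows "algebraic_connectivity (token_graph k G) = a"
proof -
  interpret pair_graph G by fact
  have "p \<noteq> q" using pq by auto
  \<comment> \<open>The range of \<open>k\<close> leaves room for \<open>k - 1\<close> tokens away
    from \<open>p\<close> and \<open>q\<close>. Completing them by \<open>p\<close> or by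
    \<open>q\<close> gives two token sets with different sums, so at least one sum is
    nonzero.\<close>
  then have "k - 1 \<le> card (pverts G - {p, q})" using pq k by (simp add: card_Diff_subset)
  then obtain S where S: "S \<subseteq> pverts G - {p, q}" "card S = k - 1" "finite S"
    using obtain_subset_with_card_n by metis
  have "insert p S \<in> ksets (pverts G) k" "insert q S \<in> ksets (pverts G) k"
    using S pq k by (auto simp: ksets_def card_insert_if)
  moreover have "sum \<phi> (insert p S) \<noteq> 0 \<or> sum \<phi> (insert q S) \<noteq> 0"
  proof -
    have "p \<notin> S" "q \<notin> S" using S(1) by auto
    then show ?thesis using S(3) pq(3) by auto
  qed
  ultimately obtain A0 where A0: "A0 \<in> ksets (pverts G) k" "sum \<phi> A0 \<noteq> 0" by blast
  show ?thesis
  proof (rule algebraic_connectivity_eqI[OF pair_graph_token_graph[OF G] a,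
        unfolded pverts_token_graph, OF _ token_graph_eigenfunction[OF G _ eig] A0])
    fix f :: "'a set \<Rightarrow> real" assume "sum f (ksets (pverts G) k) = 0"
    then have "a * (\<Sum>A\<in>ksets (pverts G) k. (f A)\<^sup>2) \<le> token_energy (arc_weight G) (pverts G) k f"
      using gap by (simp add: token_gap_def)
    also have "\<dots> = (\<Sum>A\<in>ksets (pverts G) k. \<Sum>B | (A, B) \<in> parcs (token_graph k G). (f A - f B)\<^sup>2) / 2"
      unfolding token_energy_def
      by (intro arg_cong[of _ _ "\<lambda>x. x / 2"] sum.cong refl)
        (simp add: sum_token_graph_neighbours[OF G])
    finally show "a * (\<Sum>A\<in>ksets (pverts G) k. (f A)\<^sup>2)
      \<le> (\<Sum>A\<in>ksets (pverts G) k. \<Sum>B | (A, B) \<in> parcs (token_graph k G). (f A - f B)\<^sup>2) / 2" .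
  qed
qed

text \<open>The 1-token graph is \<open>G\<close> itself under \<open>u \<mapsto> {u}\<close>, so
  the gap for one token is the gap of \<open>G\<close>.\<close>

lemma algebraic_connectivity_eqI_token_gap:
  fixes a :: real
  assumes G: "pair_graph G" and a: "a > 0" and gap: "token_gap (arc_weight G) (pverts G) 1 a"
    and eig: "\<And>u. u \<in> pverts G \<Longrightarrow> (\<Sum>v | (u, v) \<in> parcs G. \<phi> u - \<phi> v) = a * \<phi> u"
    and nz: "u0 \<in> pverts G" "\<phi> u0 \<noteq> 0"
  shows "algebraic_connectivity G = a"
proof (rule algebraic_connectivity_eqI[OF G a _ eig nz])
  interpret pair_graph G by fact
  let ?V = "pverts G"
  fix f :: "'a \<Rightarrow> real" assume f0: "(\<Sum>u\<in>?V. f u) = 0"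
  define F where "F A = f (the_elem A)" for A
  have K: "ksets ?V 1 = (\<lambda>x. {x}) ` ?V"
    by (auto simp: ksets_def card_1_singleton_iff)
  have sum1: "sum h (ksets ?V 1) = (\<Sum>u\<in>?V. h {u})" for h :: "'a set \<Rightarrow> real"
    unfolding K by (subst sum.reindex) auto
  have "a * (\<Sum>u\<in>?V. (f u)\<^sup>2) \<le> token_energy (arc_weight G) ?V 1 F"
    using gap[unfolded token_gap_def sum1, rule_format, of F] f0 by (simp add: F_def)
  also have "\<dots> = (\<Sum>u\<in>?V. \<Sum>v\<in>?V - {u}. arc_weight G u v * (f u - f v)\<^sup>2) / 2"
    unfolding token_energy_def sum1 by (simp add: F_def)
  also have "\<dots> = (\<Sum>u\<in>?V. \<Sum>v\<in>?V. arc_weight G u v * (f u - f v)\<^sup>2) / 2"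
    by (intro arg_cong[of _ _ "\<lambda>x. x / 2"] sum.cong refl sum.mono_neutral_left) auto
  finally show "a * (\<Sum>u\<in>?V. (f u)\<^sup>2) \<le> (\<Sum>u\<in>?V. \<Sum>v | (u, v) \<in> parcs G. (f u - f v)\<^sup>2) / 2"
    by (simp add: sum_neighbours_arc_weight[OF G])
qed

theorem theorem3p10:
  fixes X Y :: "'a set" and n1 n2 n k :: nat
  assumes "finite X" and "finite Y" and "X \<inter> Y = {}"
    and "card X = n1" and "card Y = n2" and "n = n1 + n2"
    and "2 \<le> n1" and "n1 \<le> n2"
    and "1 \<le> k" and "k \<le> n - 1"
  shows "algebraic_connectivity (token_graph k (complete_bipartite_star X Y))
           = algebraic_connectivity (complete_bipartite_star X Y)
       \<and> algebraic_connectivity (complete_bipartite_star X Y) = real n2"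
proof -
  define G where "G = complete_bipartite_star X Y"
  have V: "pverts G = X \<union> Y"
    by (simp add: G_def complete_bipartite_star_def complete_bipartite_def)
  have arcs: "(u, v) \<in> parcs G \<longleftrightarrow> (u \<in> X \<and> v \<in> Y \<or> u \<in> Y \<and> v \<in> X \<or> u \<in> Y \<and> v \<in> Y \<and> u \<noteq> v)" for u v
    by (auto simp: G_def complete_bipartite_star_def complete_bipartite_def)
  have G: "pair_graph G" unfolding G_def using assms by (intro pair_graph_complete_bipartite_star)
  \<comment> \<open>The bound is proved for a generic number of tokens; the instances 1 and the
    given \<open>k\<close> are both needed.\<close>
  have gap: "token_gap (arc_weight G) (pverts G) k (real n2)" for k
    unfolding V assms(5)[symmetric]
    by (rule token_gap_union_dominating) (use assms(1-3) in \<open>auto simp: arc_weight_def arcs\<close>)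
  \<comment> \<open>Two distinct vertices of \<open>X\<close> exist because
    \<open>2 \<le> n1\<close>. They have the same neighbourhood \<open>Y\<close>, so the difference
    of their indicators is an eigenfunction for their common degree \<open>n2\<close>.\<close>
  obtain p q where pq: "p \<in> X" "q \<in> X" "p \<noteq> q"
    using assms by (metis card_le_Suc0_iff_eq not_less_eq_eq numeral_2_eq_2)
  define \<phi> where "\<phi> u = (if u = p then 1 else 0) - (if u = q then 1 else (0::real))" for u
  have eig: "(\<Sum>v | (u, v) \<in> parcs G. \<phi> u - \<phi> v) = real n2 * \<phi> u" if "u \<in> pverts G" for u
  proof (cases "u \<in> X")
    case True
    then have "{v. (u, v) \<in> parcs G} = Y" using assms(3) by (auto simp: arcs)
    moreover have "\<phi> v = 0" if "v \<in> Y" for v using that pq assms(3) by (auto simp: \<phi>_def)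
    ultimately show ?thesis using assms by simp
  next
    \<comment> \<open>At a vertex of \<open>Y\<close> the function is 0 and the neighbours are all
      other vertices, over which the values 1 and -1 cancel.\<close>
    case False
    then have u: "u \<in> Y" using that V by simp
    then have "{v. (u, v) \<in> parcs G} = X \<union> Y - {u}" using assms(3) by (auto simp: arcs)
    moreover have "\<phi> u = 0" using False pq by (auto simp: \<phi>_def)
    moreover have "sum \<phi> (X \<union> Y) = 0" using assms pq by (simp add: \<phi>_def sum_subtractf)
    ultimately show ?thesis using assms u by (simp add: sum_negf sum_diff1)
  qed
  have "algebraic_connectivity G = real n2"
    by (rule algebraic_connectivity_eqI_token_gap[OF G _ gap eig, of p])
      (use assms pq V in \<open>auto simp: \<phi>_def\<close>)
  moreover have "algebraic_connectivity (token_graph k G) = real n2"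
    by (rule algebraic_connectivity_token_graph_eqI[OF G _ gap eig, of p q])
      (use assms pq V in \<open>auto simp: \<phi>_def card_Un_disjoint\<close>)
  ultimately show ?thesis by (simp add: G_def)
qed

end
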